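(* Let $X\subset\mathbb{P}^4_{x_1,\dots,x_5}$ be the real cubic threefold given by $$(x_1^2+x_2^2)x_3+t_1x_3^3+x_3^2(t_2x_4+t_3x_5)+x_3(t_4x_4^2+t_5x_5^2+t_6x_4x_5)+x_4(x_4^2+x_5^2)=0,$$ where $t_1,\dots,t_6\in\mathbb{R}$ are general parameters, in the sense that $X$ has no real singular points and $X_{\mathbb{C}}$ has exactly $2\mathsf{D}_4$-singularities. Let $$D_2(x)=x^4+(t_4+t_5)x^3+\left(t_2+t_4t_5-\tfrac14t_6^2\right)x^2+\left(t_1+t_2t_5-\tfrac12t_3t_6\right)x+t_1t_5-\tfrac14t_3^2\in\mathbb{R}[x].$$ Then $X(\mathbb{R})$ is connected if and only if one of the following holds: - $D_2$ has no real root; - $D_2$ has $2$ real roots $\alpha_1<\alpha_2$ and $\alpha_1\le -t_5$; - $D_2$ has $4$ real roots $\alpha_1<\alpha_2<\alpha_3<\alpha_4$ and $\alpha_3\le -t_5$.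
   Context: $X_{\mathbb{C}}$ denotes the base change of $X$ to $\mathbb{C}$. "$X_{\mathbb{C}}$ has $2\mathsf{D}_4$-singularities" means that its singular locus consists of exactly two points, each locally analytically isomorphic to $x^2+y^2+z^2w+w^3=0$; here these points are $[1:\pm i:0:0:0]$. In this situation $X_{\mathbb{C}}$ contains exactly three planes, only one of which, $\{x_3=x_4=0\}$, is defined over $\mathbb{R}$. *)

theory Defs
  imports "HOL-Analysis.Analysis"
begin

section \<open>Projective space and its quotient topology\<close>

text \<open>A point of projective space is a line through the origin; homogeneous coordinates
  are indexed by the type \<open>'n\<close>, so \<open>'n = 5\<close> gives \<open>P\<^sup>4\<close>.\<close>

definition proj_point :: "'a::field ^ 'n \<Rightarrow> ('a ^ 'n) set" where
  "proj_point x = range (\<lambda>c. c *s x)"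

definition proj_space :: "('a::field ^ 'n) set set" where
  "proj_space = proj_point ` (- {0})"

definition proj_topology :: "(('a::real_normed_field) ^ 'n) set topology" where
  "proj_topology =
     topology (\<lambda>U. U \<subseteq> proj_space \<and> open {x. x \<noteq> 0 \<and> proj_point x \<in> U})"

lemma openin_proj_topology:
  fixes U :: "('a::real_normed_field ^ 'n) set set"
  shows "openin proj_topology U \<longleftrightarrow> U \<subseteq> proj_space \<and> open {x. x \<noteq> 0 \<and> proj_point x \<in> U}"
proof -
  let ?P = "\<lambda>U :: ('a ^ 'n) set set. U \<subseteq> proj_space \<and> open {x. x \<noteq> 0 \<and> proj_point x \<in> U}"
  have "istopology ?P"
    unfolding istopology_def
  proof (intro conjI allI impI)
    fix S T :: "('a ^ 'n) set set" assume "?P S" "?P T"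
    moreover have "{x. x \<noteq> 0 \<and> proj_point x \<in> S \<inter> T} =
        {x. x \<noteq> 0 \<and> proj_point x \<in> S} \<inter> {x. x \<noteq> 0 \<and> proj_point x \<in> T}"
      by auto
    ultimately show "S \<inter> T \<subseteq> proj_space" "open {x. x \<noteq> 0 \<and> proj_point x \<in> S \<inter> T}"
      by auto
  next
    fix K :: "('a ^ 'n) set set set" assume K: "\<forall>S\<in>K. ?P S"
    have "{x. x \<noteq> 0 \<and> proj_point x \<in> \<Union>K} = (\<Union>S\<in>K. {x. x \<noteq> 0 \<and> proj_point x \<in> S})"
      by auto
    with K show "\<Union>K \<subseteq> proj_space" "open {x. x \<noteq> 0 \<and> proj_point x \<in> \<Union>K}"
      by (auto intro: open_UN)
  qed
  then show ?thesis
    by (simp add: proj_topology_def topology_inverse')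
qed


section \<open>Hypersurfaces and their singular points\<close>

text \<open>A hypersurface is given by a homogeneous polynomial function \<open>F\<close>.\<close>

definition proj_hypersurface :: "('a::field ^ 'n \<Rightarrow> 'a) \<Rightarrow> ('a ^ 'n) set set" where
  "proj_hypersurface F = proj_point ` {x. x \<noteq> 0 \<and> F x = 0}"

text \<open>The points of the hypersurface at which all partial derivatives of \<open>F\<close> vanish.\<close>

definition sing_locus :: "('a::real_normed_field ^ 'n \<Rightarrow> 'a) \<Rightarrow> ('a ^ 'n) set set" where
  "sing_locus F = proj_point ` {x. x \<noteq> 0 \<and> F x = 0 \<and>
     (\<forall>i. ((\<lambda>z. F (\<chi> j. if j = i then z else x $ j)) has_field_derivative 0) (at (x $ i)))}"


section \<open>Analytic type of hypersurface singularities\<close>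

definition holomorphic_map_on :: "(complex ^ 'm \<Rightarrow> complex ^ 'n) \<Rightarrow> (complex ^ 'm) set \<Rightarrow> bool" where
  "holomorphic_map_on f U \<longleftrightarrow>
     (\<forall>x\<in>U. \<exists>J :: complex ^ 'm ^ 'n. (f has_derivative (\<lambda>v. J *v v)) (at x))"

definition holomorphic_fun_on :: "(complex ^ 'm \<Rightarrow> complex) \<Rightarrow> (complex ^ 'm) set \<Rightarrow> bool" where
  "holomorphic_fun_on f U \<longleftrightarrow>
     (\<forall>x\<in>U. \<exists>a :: complex ^ 'm. (f has_derivative (\<lambda>v. \<Sum>i\<in>UNIV. a $ i * v $ i)) (at x))"

text \<open>The germs at \<open>p\<close> and \<open>q\<close> of the complex analytic spaces \<open>f = 0\<close> and \<open>g = 0\<close> are isomorphic: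
  some germ of a biholomorphic map \<open>\<phi>\<close> with \<open>\<phi> q = p\<close> carries the ideal generated by \<open>f\<close> to the one
  generated by \<open>g\<close>, that is, \<open>f \<circ> \<phi>\<close> is \<open>g\<close> times a unit (contact equivalence of \<open>f\<close> and \<open>g\<close>).\<close>

definition isomorphic_germs ::
    "(complex ^ 'm \<Rightarrow> complex) \<Rightarrow> complex ^ 'm \<Rightarrow> (complex ^ 'm \<Rightarrow> complex) \<Rightarrow> complex ^ 'm \<Rightarrow> bool" where
  "isomorphic_germs f p g q \<longleftrightarrow>
     (\<exists>U V \<phi> \<psi> u. open U \<and> p \<in> U \<and> open V \<and> q \<in> V \<and>
        homeomorphism V U \<phi> \<psi> \<and> holomorphic_map_on \<phi> V \<and> holomorphic_map_on \<psi> U \<and> \<phi> q = p \<and>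
        holomorphic_fun_on u V \<and> (\<forall>y\<in>V. u y \<noteq> 0 \<and> f (\<phi> y) = u y * g y))"

text \<open>The affine chart of projective space in which the \<open>k\<close>-th homogeneous coordinate is \<open>1\<close>;
  the injection \<open>e\<close> with range \<open>- {k}\<close> numbers the remaining coordinates.\<close>

definition affine_chart :: "'n \<Rightarrow> ('m \<Rightarrow> 'n) \<Rightarrow> 'a::one ^ 'm \<Rightarrow> 'a ^ 'n" where
  "affine_chart k e y = (\<chi> i. if i = k then 1 else y $ inv e i)"

definition D4_eq :: "complex ^ 4 \<Rightarrow> complex" where
  "D4_eq y = (y $ 1)\<^sup>2 + (y $ 2)\<^sup>2 + (y $ 3)\<^sup>2 * y $ 4 + (y $ 4) ^ 3"

definition is_D4_singularity :: "(complex ^ 5 \<Rightarrow> complex) \<Rightarrow> (complex ^ 5) set \<Rightarrow> bool" where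
  "is_D4_singularity F P \<longleftrightarrow>
     (\<exists>k (e :: 4 \<Rightarrow> 5) p. bij_betw e UNIV (- {k}) \<and> proj_point (affine_chart k e p) = P \<and>
        isomorphic_germs (F \<circ> affine_chart k e) p D4_eq 0)"

definition has_2D4_singularities :: "(complex ^ 5 \<Rightarrow> complex) \<Rightarrow> bool" where
  "has_2D4_singularities F \<longleftrightarrow>
     card (sing_locus F) = 2 \<and> (\<forall>P\<in>sing_locus F. is_D4_singularity F P)"


section \<open>The cubic threefold and the quartic \<open>D\<^sub>2\<close>\<close>

text \<open>The same real equation defines the real threefold (\<open>'a = real\<close>) and its base change to the
  complex numbers (\<open>'a = complex\<close>).\<close>

definition cubic ::
    "real \<Rightarrow> real \<Rightarrow> real \<Rightarrow> real \<Rightarrow> real \<Rightarrow> real \<Rightarrow> 'a::real_normed_field ^ 5 \<Rightarrow> 'a" where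
  "cubic t1 t2 t3 t4 t5 t6 x =
     ((x$1)\<^sup>2 + (x$2)\<^sup>2) * x$3 + of_real t1 * (x$3) ^ 3
     + (x$3)\<^sup>2 * (of_real t2 * x$4 + of_real t3 * x$5)
     + x$3 * (of_real t4 * (x$4)\<^sup>2 + of_real t5 * (x$5)\<^sup>2 + of_real t6 * (x$4) * (x$5))
     + x$4 * ((x$4)\<^sup>2 + (x$5)\<^sup>2)"

definition D2 :: "real \<Rightarrow> real \<Rightarrow> real \<Rightarrow> real \<Rightarrow> real \<Rightarrow> real \<Rightarrow> real poly" where
  "D2 t1 t2 t3 t4 t5 t6 =
     [: t1 * t5 - 1/4 * t3\<^sup>2,
        t1 + t2 * t5 - 1/2 * t3 * t6,
        t2 + t4 * t5 - 1/4 * t6\<^sup>2,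
        t4 + t5,
        1 :]"

end

theory Submission
  imports Defs
begin

text \<open>In the chart \<open>x\<^sub>3 = 1\<close>, \<open>x\<^sub>4 = x\<close>, \<open>x\<^sub>5 = y\<close> the threefold is
  \<open>x\<^sub>1\<^sup>2 + x\<^sub>2\<^sup>2 = - (A y\<^sup>2 + B y + C)\<close> with \<open>A = x + t\<^sub>5\<close>, \<open>B\<close>, \<open>C\<close> polynomials in \<open>x\<close> and
  \<open>A C - B\<^sup>2 / 4 = D\<^sub>2\<close>; at infinity it is the real plane \<open>x\<^sub>3 = x\<^sub>4 = 0\<close>. Over \<open>x \<le> - t\<^sub>5\<close> every
  point escapes to the plane along a half line in the direction of \<open>y\<close>. Over \<open>x > - t\<^sub>5\<close> the
  slices are compact, and nonempty exactly where \<open>D\<^sub>2 \<le> 0\<close>; the family of their midpoints leads to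
  the plane, or to the slice at \<open>- t\<^sub>5\<close>, unless an interval with \<open>D\<^sub>2 > 0\<close> intervenes, in which
  case a compact part of the threefold splits off. A real double root of \<open>D\<^sub>2\<close> would give a singular
  point besides \<open>[1 : \<plusminus>i : 0 : 0 : 0]\<close>, so the roots are simple, and since
  \<open>D\<^sub>2 (- t\<^sub>5) \<le> 0\<close> there are two or four of them.\<close>

section \<open>Coordinates on five-dimensional space\<close>

lemma exhaust_5:
  fixes i :: 5
  shows "i = 1 \<or> i = 2 \<or> i = 3 \<or> i = 4 \<or> i = 5"
proof (induct i)
  case (of_int z)
  then have "0 \<le> z" "z < 5" by simp_all
  then have "z = 0 \<or> z = 1 \<or> z = 2 \<or> z = 3 \<or> z = 4" by arith
  then show ?case by auto
qed

lemma forall_5: "(\<forall>i::5. P i) \<longleftrightarrow> P 1 \<and> P 2 \<and> P 3 \<and> P 4 \<and> P 5"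
  by (metis exhaust_5)

definition vec5 :: "'a \<Rightarrow> 'a \<Rightarrow> 'a \<Rightarrow> 'a \<Rightarrow> 'a \<Rightarrow> 'a ^ 5" where
  "vec5 p q r s t = (\<chi> i. if i = 1 then p else if i = 2 then q else if i = 3 then r
     else if i = 4 then s else t)"

lemma vec5_nth [simp]:
  "vec5 p q r s t $ 1 = p" "vec5 p q r s t $ 2 = q" "vec5 p q r s t $ 3 = r"
  "vec5 p q r s t $ 4 = s" "vec5 p q r s t $ 5 = t"
  by (simp_all add: vec5_def)

lemma vec5_eta: "vec5 (v $ 1) (v $ 2) (v $ 3) (v $ 4) (v $ 5) = v"
  by (simp add: vec_eq_iff forall_5)

lemma vec5_eq_0_iff: "vec5 p q r s t = 0 \<longleftrightarrow> p = 0 \<and> q = 0 \<and> r = 0 \<and> s = 0 \<and> t = 0"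
  by (simp add: vec_eq_iff forall_5)

lemma scaleR_vec5:
  "k *\<^sub>R vec5 p q r s t = vec5 (k *\<^sub>R p) (k *\<^sub>R q) (k *\<^sub>R r) (k *\<^sub>R s) (k *\<^sub>R t)"
  by (simp add: vec_eq_iff forall_5)

lemma continuous_on_vec5 [continuous_intros]:
  assumes "continuous_on S p" "continuous_on S q" "continuous_on S r" "continuous_on S s"
    "continuous_on S t"
  shows "continuous_on S (\<lambda>x. vec5 (p x) (q x) (r x) (s x) (t x))"
  unfolding vec5_def
proof (intro continuous_on_vec_lambda)
  fix i :: 5
  show "continuous_on S (\<lambda>x. if i = 1 then p x else if i = 2 then q x else if i = 3 then r x
     else if i = 4 then s x else t x)"
    using assms by (cases "i = 1"; cases "i = 2"; cases "i = 3"; cases "i = 4") simp_all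
qed


section \<open>Projective space\<close>

lemma proj_point_eqD: "proj_point v = proj_point w \<Longrightarrow> \<exists>c. w = c *s v"
proof -
  assume "proj_point v = proj_point w"
  moreover have "w \<in> proj_point w"
    unfolding proj_point_def by (rule range_eqI[of _ _ 1]) simp
  ultimately show ?thesis by (auto simp: proj_point_def)
qed

text \<open>A set stable under nonzero scalars is a union of punctured lines, hence the full
  preimage of its image. This transfers openness and membership between vectors and projective
  points.\<close>

lemma proj_point_image_scale_invariant:
  fixes S :: "(real ^ 'n) set"
  assumes "open S" "0 \<notin> S" and scale: "\<forall>v\<in>S. \<forall>c. c \<noteq> 0 \<longrightarrow> c *s v \<in> S"
  shows "openin proj_topology (proj_point ` S)"
    and "\<And>v. v \<noteq> 0 \<Longrightarrow> proj_point v \<in> proj_point ` S \<longleftrightarrow> v \<in> S"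
proof -
  show mem: "proj_point v \<in> proj_point ` S \<longleftrightarrow> v \<in> S" if "v \<noteq> 0" for v
  proof
    assume "proj_point v \<in> proj_point ` S"
    then obtain w where w: "w \<in> S" "proj_point w = proj_point v" by auto
    obtain c where "v = c *s w" using proj_point_eqD[OF w(2)] by blast
    moreover have "c \<noteq> 0" using calculation that by auto
    ultimately show "v \<in> S" using scale w(1) by simp
  qed simp
  have "{x. x \<noteq> 0 \<and> proj_point x \<in> proj_point ` S} = S"
    using mem assms(2) by auto
  moreover have "proj_point ` S \<subseteq> proj_space"
    using assms(2) by (auto simp: proj_space_def)
  ultimately show "openin proj_topology (proj_point ` S)"
    using assms(1) by (simp add: openin_proj_topology)
qed

lemma topspace_proj_topology:
  "topspace (proj_topology :: ('a::real_normed_field ^ 'n) set topology) = proj_space"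
proof (rule antisym)
  show "topspace proj_topology \<subseteq> (proj_space :: ('a ^ 'n) set set)"
    using openin_topspace openin_proj_topology by blast
  have "{x. x \<noteq> 0 \<and> proj_point x \<in> (proj_space :: ('a ^ 'n) set set)} = - {0}"
    by (auto simp: proj_space_def)
  then have "openin proj_topology (proj_space :: ('a ^ 'n) set set)"
    by (simp add: openin_proj_topology open_Compl)
  then show "(proj_space :: ('a ^ 'n) set set) \<subseteq> topspace proj_topology"
    by (rule openin_subset)
qed

lemma continuous_map_proj_point:
  "continuous_map (top_of_set (- {0})) proj_topology
     (proj_point :: 'a::real_normed_field ^ 'n \<Rightarrow> _)"
  unfolding continuous_map_def
proof (intro conjI allI impI)
  show "proj_point \<in> topspace (top_of_set (- {0 :: 'a ^ 'n})) \<rightarrow> topspace proj_topology"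
    by (auto simp: topspace_proj_topology proj_space_def)
next
  fix U :: "('a ^ 'n) set set" assume "openin proj_topology U"
  then have "open {x. x \<noteq> 0 \<and> proj_point x \<in> U}" by (simp add: openin_proj_topology)
  moreover have "{x \<in> topspace (top_of_set (- {0})). proj_point x \<in> U} =
      {x. x \<noteq> 0 \<and> proj_point x \<in> U}" by auto
  ultimately show "openin (top_of_set (- {0})) {x \<in> topspace (top_of_set (- {0})). proj_point x \<in> U}"
    by (auto simp: openin_open)
qed

lemma connectedin_proj_point_image:
  fixes Z :: "('a::real_normed_field ^ 'n) set"
  assumes "connected Z" "0 \<notin> Z"
  shows "connectedin proj_topology (proj_point ` Z)"
  by (rule connectedin_continuous_map_image[OF continuous_map_proj_point])
     (use assms in \<open>auto simp: connectedin_subtopology\<close>)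


section \<open>Monic real quartics with simple roots\<close>

lemma real_poly_root_between:
  fixes p :: "real poly"
  assumes "a \<le> b" "poly p a \<le> 0" "0 \<le> poly p b"
  shows "\<exists>x. a \<le> x \<and> x \<le> b \<and> poly p x = 0"
  by (rule IVT') (use assms in \<open>auto intro!: continuous_intros\<close>)

lemma monic_real_cubic_root:
  fixes u v w :: real
  shows "\<exists>x. x ^ 3 + u * x\<^sup>2 + v * x + w = 0"
proof -
  have "\<exists>n. \<forall>x\<ge>n. poly [:w, v, u, 1:] x \<ge> 1"
    using poly_pinfty_gt_lc[of "[:w, v, u, 1:]"] by simp
  then obtain m where m: "\<And>x. x \<ge> m \<Longrightarrow> poly [:w, v, u, 1:] x \<ge> 1" by blast
  have "\<exists>n. \<forall>x\<ge>n. poly [:- w, v, - u, 1:] x \<ge> 1"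
    using poly_pinfty_gt_lc[of "[:- w, v, - u, 1:]"] by simp
  then obtain n where n: "\<And>x. x \<ge> n \<Longrightarrow> poly [:- w, v, - u, 1:] x \<ge> 1" by blast
  define N where "N = max 0 (max m n)"
  have "poly [:- w, v, - u, 1:] N \<ge> 1" "poly [:w, v, u, 1:] N \<ge> 1" "- N \<le> N"
    using m n by (auto simp: N_def)
  moreover have "poly [:w, v, u, 1:] (- N) = - poly [:- w, v, - u, 1:] N"
    by (simp add: algebra_simps)
  ultimately obtain x where "poly [:w, v, u, 1:] x = 0"
    using real_poly_root_between[of "- N" N "[:w, v, u, 1:]"] by (auto simp del: poly_pCons)
  then have "x ^ 3 + u * x\<^sup>2 + v * x + w = 0"
    by (simp add: algebra_simps power2_eq_square power3_eq_cube)
  then show ?thesis by blast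
qed

text \<open>The product of the linear factors depends only on the multiset of roots, so the roots
  may be sorted.\<close>

lemma four_distinct_factors_sorted:
  fixes f :: "real \<Rightarrow> real"
  assumes "\<And>x. f x = (x - a) * (x - b) * (x - c) * (x - d)" and "distinct [a, b, c, d]"
  obtains a' b' c' d' where "a' < b'" "b' < c'" "c' < d'"
    "\<And>x. f x = (x - a') * (x - b') * (x - c') * (x - d')"
proof -
  define l where "l = sort [a, b, c, d]"
  have "length l = 4" "sorted_wrt (<) l"
    using assms(2) unfolding l_def by (simp, metis distinct_sort sorted_sort strict_sorted_iff)
  then obtain a' b' c' d' where l: "l = [a', b', c', d']"
    by (auto simp: numeral_eq_Suc length_Suc_conv)
  have "f x = (\<Prod>r\<leftarrow>l. x - r)" for x
  proof -
    have "mset l = mset [a, b, c, d]" by (simp add: l_def)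
    then have "prod_mset (image_mset (\<lambda>r. x - r) (mset l))
        = prod_mset (image_mset (\<lambda>r. x - r) (mset [a, b, c, d]))" by simp
    then show ?thesis unfolding assms(1)
      by (simp flip: prod_mset_prod_list mset_map)
  qed
  then show ?thesis using that[of a' b' c' d'] \<open>sorted_wrt (<) l\<close> unfolding l
    by (simp add: mult.assoc)
qed

text \<open>The value at \<open>s\<close> and the leading coefficient 1 give one root, the cubic
  quotient has another, and the remaining quadratic either splits or is positive everywhere. The
  hypothesis \<open>simple\<close> keeps the roots apart.\<close>

lemma monic_quartic_simple_roots:
  fixes p :: "real \<Rightarrow> real"
  assumes p: "\<And>x. p x = x ^ 4 + p3 * x ^ 3 + p2 * x\<^sup>2 + p1 * x + p0"
    and s: "p s \<le> 0"
    and simple: "\<forall>x. p x = 0 \<longrightarrow> 4 * x ^ 3 + 3 * p3 * x\<^sup>2 + 2 * p2 * x + p1 \<noteq> 0"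
  obtains a b where "a < b" "\<And>x. p x = 0 \<longleftrightarrow> x = a \<or> x = b"
      "\<And>x. p x \<le> 0 \<longleftrightarrow> a \<le> x \<and> x \<le> b"
  | a b c d where "a < b" "b < c" "c < d"
      "\<And>x. p x = (x - a) * (x - b) * (x - c) * (x - d)"
proof -
  \<comment> \<open>A squared linear factor would make the derivative vanish at its root.\<close>
  have no_double: False if "\<And>x. p x = (x - r)\<^sup>2 * (x\<^sup>2 + m * x + n)" for r m n
  proof -
    have "(p has_field_derivative 4 * r ^ 3 + 3 * p3 * r\<^sup>2 + 2 * p2 * r + p1) (at r)"
      unfolding p by (auto intro!: derivative_eq_intros simp: algebra_simps)
    moreover have "(p has_field_derivative 0) (at r)"
      unfolding that by (auto intro!: derivative_eq_intros)
    ultimately have "4 * r ^ 3 + 3 * p3 * r\<^sup>2 + 2 * p2 * r + p1 = 0"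
      by (rule DERIV_unique)
    then show False using simple that[of r] by simp
  qed
  have poly: "poly [:p0, p1, p2, p3, 1:] x = p x" for x
    unfolding p by (simp add: algebra_simps power2_eq_square power3_eq_cube power4_eq_xxxx)
  have "\<exists>n. \<forall>x\<ge>n. p x \<ge> 1"
    using poly_pinfty_gt_lc[of "[:p0, p1, p2, p3, 1:]"] unfolding poly by simp
  then obtain n where n: "\<And>x. x \<ge> n \<Longrightarrow> p x \<ge> 1" by blast
  define N where "N = max s n"
  have "s \<le> N" "p N \<ge> 1" using n by (auto simp: N_def)
  then obtain r1 where r1: "p r1 = 0"
    using real_poly_root_between[of s N "[:p0, p1, p2, p3, 1:]"] s
    unfolding poly by auto
  \<comment> \<open>Coefficients of the quotient by \<open>x - r1\<close>, from Horner's
    scheme.\<close>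
  define u v w where "u = p3 + r1" and "v = p2 + r1 * u" and "w = p1 + r1 * v"
  have "w * r1 = - p0"
    using r1 unfolding p u_def v_def w_def by algebra
  then have f1: "p x = (x - r1) * (x ^ 3 + u * x\<^sup>2 + v * x + w)" for x
    unfolding p u_def v_def w_def by algebra
  obtain r2 where r2: "r2 ^ 3 + u * r2\<^sup>2 + v * r2 + w = 0"
    using monic_real_cubic_root by blast
  \<comment> \<open>Horner's scheme again, dividing the cubic by \<open>x - r2\<close>.\<close>
  define m n where "m = u + r2" and "n = v + r2 * m"
  have f2: "p x = (x - r1) * (x - r2) * (x\<^sup>2 + m * x + n)" for x
    using r2 unfolding f1 m_def n_def by algebra
  have "r1 \<noteq> r2"
    using no_double[of r1 m n] f2 by (auto simp: power2_eq_square)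
  show ?thesis
  proof (cases "\<exists>x. x\<^sup>2 + m * x + n = 0")
    case True
    then obtain r3 where r3: "r3\<^sup>2 + m * r3 + n = 0" by blast
    \<comment> \<open>By Vieta, the two roots of the quadratic add up to \<open>- m\<close>.\<close>
    define r4 where "r4 = - m - r3"
    have f3: "p x = (x - r1) * (x - r2) * (x - r3) * (x - r4)" for x
      using r3 unfolding f2 r4_def by algebra
    have "r3 \<noteq> r1"
      using no_double[of r1 "- r2 - r4" "r2 * r4"] unfolding f3
      by (auto simp: power2_eq_square algebra_simps)
    moreover have "r4 \<noteq> r1"
      using no_double[of r1 "- r2 - r3" "r2 * r3"] unfolding f3
      by (auto simp: power2_eq_square algebra_simps)
    moreover have "r3 \<noteq> r2"
      using no_double[of r2 "- r1 - r4" "r1 * r4"] unfolding f3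
      by (auto simp: power2_eq_square algebra_simps)
    moreover have "r4 \<noteq> r2"
      using no_double[of r2 "- r1 - r3" "r1 * r3"] unfolding f3
      by (auto simp: power2_eq_square algebra_simps)
    moreover have "r4 \<noteq> r3"
      using no_double[of r3 "- r1 - r2" "r1 * r2"] unfolding f3
      by (auto simp: power2_eq_square algebra_simps)
    ultimately have "distinct [r1, r2, r3, r4]" using \<open>r1 \<noteq> r2\<close> by auto
    from four_distinct_factors_sorted[OF f3 this] show ?thesis using that(2) by blast
  next
    case False
    have pos: "x\<^sup>2 + m * x + n > 0" for x
    proof -
      have "4 * n - m\<^sup>2 > 0"
      proof (rule ccontr)
        assume "\<not> 4 * n - m\<^sup>2 > 0"
        then have "(sqrt (m\<^sup>2 - 4 * n))\<^sup>2 = m\<^sup>2 - 4 * n" by simp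
        then have "((- m + sqrt (m\<^sup>2 - 4 * n)) / 2)\<^sup>2 + m * ((- m + sqrt (m\<^sup>2 - 4 * n)) / 2) + n = 0"
          by (simp add: power2_eq_square field_simps)
        with False show False by blast
      qed
      moreover have "x\<^sup>2 + m * x + n = (x + m / 2)\<^sup>2 + (4 * n - m\<^sup>2) / 4"
        by (simp add: power2_eq_square field_simps)
      ultimately show ?thesis by (simp add: add_nonneg_pos)
    qed
    define a b where "a = min r1 r2" and "b = max r1 r2"
    have f: "p x = ((x - a) * (x - b)) * (x\<^sup>2 + m * x + n)" for x
      unfolding f2 a_def b_def by (simp add: min_def max_def)
    show ?thesis
    proof (rule that(1)[of a b])
      show "a < b" using \<open>r1 \<noteq> r2\<close> by (auto simp: a_def b_def)
      show "p x = 0 \<longleftrightarrow> x = a \<or> x = b" for x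
        using pos[of x] unfolding f by auto
      show "p x \<le> 0 \<longleftrightarrow> a \<le> x \<and> x \<le> b" for x
        using pos[of x] \<open>a < b\<close> unfolding f by (auto simp: mult_le_0_iff)
    qed
  qed
qed

text \<open>The factors are grouped in pairs: each quadratic is nonpositive exactly between its
  roots, and these two intervals are disjoint.\<close>

lemma four_factors_le_0_iff:
  fixes a b c d x :: real
  assumes "a < b" "b < c" "c < d"
  shows "(x - a) * (x - b) * (x - c) * (x - d) \<le> 0 \<longleftrightarrow> a \<le> x \<and> x \<le> b \<or> c \<le> x \<and> x \<le> d"
proof -
  have le: "(x - u) * (x - v) \<le> 0 \<longleftrightarrow> u \<le> x \<and> x \<le> v"
    and ge: "0 \<le> (x - u) * (x - v) \<longleftrightarrow> x \<le> u \<or> v \<le> x" if "u < v" for u v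
    using that by (auto simp: mult_le_0_iff zero_le_mult_iff)
  have "(x - a) * (x - b) * (x - c) * (x - d) = ((x - a) * (x - b)) * ((x - c) * (x - d))"
    by (simp add: mult.assoc)
  also have "\<dots> \<le> 0 \<longleftrightarrow> a \<le> x \<and> x \<le> b \<or> c \<le> x \<and> x \<le> d"
    unfolding mult_le_0_iff[of "(x - a) * (x - b)"] le[OF assms(1)] le[OF assms(3)]
      ge[OF assms(1)] ge[OF assms(3)]
    using assms by linarith
  finally show ?thesis .
qed


section \<open>The conic bundle over the line of slopes\<close>

locale cubic_threefold =
  fixes t1 t2 t3 t4 t5 t6 :: real
begin

definition A :: "real \<Rightarrow> real" where "A x = x + t5"
definition B :: "real \<Rightarrow> real" where "B x = t6 * x + t3"
definition C :: "real \<Rightarrow> real" where "C x = x ^ 3 + t4 * x\<^sup>2 + t2 * x + t1"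
text \<open>Up to the factor -4 this is the discriminant of \<open>slice x y\<close> as a quadratic
  in \<open>y\<close>.\<close>

definition D :: "real \<Rightarrow> real" where "D x = A x * C x - (B x)\<^sup>2 / 4"
definition slice :: "real \<Rightarrow> real \<Rightarrow> real" where "slice x y = A x * y\<^sup>2 + B x * y + C x"

text \<open>The punctured affine cone over the real threefold. Curves are drawn here, among vectors,
  and connectedness then passes to the projective image.\<close>

definition zero_cone :: "(real ^ 5) set" where
  "zero_cone = {v. v \<noteq> 0 \<and> cubic t1 t2 t3 t4 t5 t6 v = 0}"
definition plane :: "(real ^ 5) set" where
  "plane = {v. v \<noteq> 0 \<and> v $ 3 = 0 \<and> v $ 4 = 0}"
definition reaches_plane :: "real ^ 5 \<Rightarrow> bool" where
  "reaches_plane v \<longleftrightarrow> (\<exists>w\<in>plane. connected_component zero_cone v w)"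

lemma poly_D2: "poly (D2 t1 t2 t3 t4 t5 t6) x = D x"
  by (simp add: D2_def D_def A_def B_def C_def field_simps power2_eq_square power3_eq_cube)

lemma D_expand:
  "D x = x ^ 4 + (t4 + t5) * x ^ 3 + (t2 + t4 * t5 - t6\<^sup>2 / 4) * x\<^sup>2
     + (t1 + t2 * t5 - t3 * t6 / 2) * x + (t1 * t5 - t3\<^sup>2 / 4)"
  by (simp add: D_def A_def B_def C_def field_simps power2_eq_square power3_eq_cube power4_eq_xxxx)

text \<open>At the zero of \<open>A\<close> only minus a square is left. This sign yields a first
  real root of \<open>D\<close> and locates \<open>- t5\<close> relative to the roots.\<close>

lemma D_neg_t5_le_0: "D (- t5) \<le> 0"
  by (simp add: D_def A_def)

text \<open>With \<open>x * u\<close> as fourth coordinate a factor \<open>u\<close> splits off. The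
  other factor is homogeneous in \<open>p\<close>, \<open>q\<close>, \<open>u\<close>,
  \<open>y\<close>, so curves on its zero set can be continued to \<open>u = 0\<close>.\<close>

lemma cubic_vec5:
  "cubic t1 t2 t3 t4 t5 t6 (vec5 p q u (x * u) y :: real ^ 5)
     = u * (p\<^sup>2 + q\<^sup>2 + C x * u\<^sup>2 + B x * u * y + A x * y\<^sup>2)"
  unfolding cubic_def A_def B_def C_def vec5_nth of_real_eq_id id_apply by algebra

lemma vec5_in_zero_coneI:
  assumes "p\<^sup>2 + q\<^sup>2 + C x * u\<^sup>2 + B x * u * y + A x * y\<^sup>2 = 0" "vec5 p q u (x * u) y \<noteq> 0"
  shows "vec5 p q u (x * u) y \<in> zero_cone"
  using assms by (simp add: zero_cone_def cubic_vec5)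

lemma affine_in_zero_cone_iff: "vec5 p q 1 x y \<in> zero_cone \<longleftrightarrow> p\<^sup>2 + q\<^sup>2 = - slice x y"
  using cubic_vec5[of p q 1 x y] by (auto simp: zero_cone_def vec5_eq_0_iff slice_def)

lemma cubic_scaleR: "cubic t1 t2 t3 t4 t5 t6 (k *\<^sub>R v :: real ^ 5) = k ^ 3 * cubic t1 t2 t3 t4 t5 t6 v"
  unfolding cubic_def vector_scaleR_component real_scaleR_def of_real_eq_id id_apply by algebra

lemma zero_cone_scaleR: "k \<noteq> 0 \<Longrightarrow> v \<in> zero_cone \<Longrightarrow> k *\<^sub>R v \<in> zero_cone"
  by (simp add: zero_cone_def cubic_scaleR)

lemma plane_subset_zero_cone: "plane \<subseteq> zero_cone"
  by (auto simp: plane_def zero_cone_def cubic_def)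

text \<open>For \<open>v $ 3 = 0\<close> the equation is a product whose second factor is a sum of
  two real squares, so either factor forces \<open>v $ 4 = 0\<close>.\<close>

lemma zero_cone_third_0: "v \<in> zero_cone \<Longrightarrow> v $ 3 = 0 \<Longrightarrow> v \<in> plane"
proof -
  assume v: "v \<in> zero_cone" "v $ 3 = 0"
  then have "v $ 4 * ((v $ 4)\<^sup>2 + (v $ 5)\<^sup>2) = 0" by (simp add: zero_cone_def cubic_def)
  then have "v $ 4 = 0" by (auto simp: sum_power2_eq_zero_iff)
  with v show ?thesis by (simp add: plane_def zero_cone_def)
qed

lemma zero_cone_normalise:
  assumes "v \<in> zero_cone" "v $ 3 \<noteq> 0"
  obtains p q x y where "v = v $ 3 *\<^sub>R vec5 p q 1 x y" "vec5 p q 1 x y \<in> zero_cone"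
proof -
  define w where "w = (1 / v $ 3) *\<^sub>R v"
  have w: "vec5 (w $ 1) (w $ 2) 1 (w $ 4) (w $ 5) = w"
    using vec5_eta[of w] assms(2) by (simp add: w_def)
  have "w \<in> zero_cone" using assms zero_cone_scaleR by (simp add: w_def)
  moreover have "v = v $ 3 *\<^sub>R w" using assms(2) by (simp add: w_def)
  ultimately show ?thesis
    using that[of "w $ 1" "w $ 2" "w $ 4" "w $ 5"] unfolding w by blast
qed

section \<open>Joining points of the cone to the plane\<close>

lemma connected_plane: "connected plane"
proof -
  have "continuous_on UNIV (\<lambda>z :: complex \<times> real. vec5 (Re (fst z)) (Im (fst z)) 0 0 (snd z))"
    by (intro continuous_intros)
  \<comment> \<open>The real dimension is three, so removing the origin does not disconnect.\<close>
  moreover have "connected (- {0 :: complex \<times> real})"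
    by (intro path_connected_imp_connected path_connected_punctured_universe) simp
  ultimately have "connected ((\<lambda>z :: complex \<times> real. vec5 (Re (fst z)) (Im (fst z)) 0 0 (snd z)) ` (- {0}))"
    by (meson connected_continuous_image continuous_on_subset subset_UNIV)
  also have "(\<lambda>z :: complex \<times> real. vec5 (Re (fst z)) (Im (fst z)) 0 0 (snd z)) ` (- {0}) = plane"
  proof (intro equalityI subsetI)
    fix v assume "v \<in> plane"
    then have "v = (\<lambda>z :: complex \<times> real. vec5 (Re (fst z)) (Im (fst z)) 0 0 (snd z))
        (Complex (v $ 1) (v $ 2), v $ 5)"
      "(Complex (v $ 1) (v $ 2), v $ 5) \<in> - {0}"
      using vec5_eta[of v] by (auto simp: plane_def vec_eq_iff forall_5 complex_eq_iff zero_prod_def)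
    then show "v \<in> (\<lambda>z :: complex \<times> real. vec5 (Re (fst z)) (Im (fst z)) 0 0 (snd z)) ` (- {0})"
      by blast
  qed (auto simp: plane_def vec5_eq_0_iff complex_eq_iff zero_prod_def)
  finally show ?thesis .
qed

lemma reaches_planeI:
  assumes "connected T" "T \<subseteq> zero_cone" "v \<in> T" "w \<in> T" "reaches_plane w"
  shows "reaches_plane v"
  using assms unfolding reaches_plane_def
  by (meson connected_componentI connected_component_trans)

lemma reaches_plane_curve:
  fixes g :: "real \<Rightarrow> real ^ 5"
  assumes "continuous_on {l..r} g" "g ` {l..r} \<subseteq> zero_cone" "s \<in> {l..r}" "t \<in> {l..r}"
    and "reaches_plane (g t)"
  shows "reaches_plane (g s)"
  by (rule reaches_planeI[of "g ` {l..r}"])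
     (use assms in \<open>auto intro: connected_continuous_image\<close>)

lemma plane_reaches_plane: "v \<in> plane \<Longrightarrow> reaches_plane v"
  using plane_subset_zero_cone unfolding reaches_plane_def by (meson connected_component_refl subsetD)

text \<open>Scaling maps both the cone and the plane into themselves, so it carries the whole
  connecting set along; this covers negative \<open>k\<close> as well.\<close>

lemma reaches_plane_scaleR:
  assumes "k \<noteq> 0" "reaches_plane v"
  shows "reaches_plane (k *\<^sub>R v)"
proof -
  obtain w T where w: "w \<in> plane" and T: "connected T" "T \<subseteq> zero_cone" "v \<in> T" "w \<in> T"
    using assms(2) by (auto simp: reaches_plane_def connected_component_def)
  show ?thesis
  proof (rule reaches_planeI)
    show "connected ((\<lambda>v. k *\<^sub>R v) ` T)" using T(1) by (intro connected_continuous_image continuous_intros)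
    show "reaches_plane (k *\<^sub>R w)"
      using w assms(1) by (intro plane_reaches_plane) (simp add: plane_def)
  qed (use T assms(1) zero_cone_scaleR in auto)
qed

text \<open>The first two coordinates enter only through the sum of their squares, so a rotation
  brings the second one to 0.\<close>

lemma reaches_plane_rotate:
  assumes "vec5 p q 1 x y \<in> zero_cone" "reaches_plane (vec5 (sqrt (- slice x y)) 0 1 x y)"
  shows "reaches_plane (vec5 p q 1 x y)"
proof -
  define R where "R = sqrt (- slice x y)"
  have pq: "p\<^sup>2 + q\<^sup>2 = - slice x y" using assms(1) by (simp add: affine_in_zero_cone_iff)
  then have R2: "R\<^sup>2 = - slice x y" unfolding R_def by (metis real_sqrt_pow2 sum_power2_ge_zero)
  obtain r \<theta> where r: "p = r * cos \<theta>" "q = r * sin \<theta>" using polar_Ex by blast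
  have "p\<^sup>2 + q\<^sup>2 = r\<^sup>2 * ((cos \<theta>)\<^sup>2 + (sin \<theta>)\<^sup>2)" unfolding r by algebra
  then have "r\<^sup>2 = R\<^sup>2" using pq R2 by simp
  define g where "g = (\<lambda>\<phi>. vec5 (r * cos \<phi>) (r * sin \<phi>) 1 x y)"
  have g: "reaches_plane (g s)" if "reaches_plane (g t)" for s t
  proof (rule reaches_planeI[of "range g"])
    show "connected (range g)"
      unfolding g_def by (intro connected_continuous_image continuous_intros) simp
    have "(r * cos \<phi>)\<^sup>2 + (r * sin \<phi>)\<^sup>2 = - slice x y" for \<phi>
    proof -
      have "(r * cos \<phi>)\<^sup>2 + (r * sin \<phi>)\<^sup>2 = r\<^sup>2 * ((cos \<phi>)\<^sup>2 + (sin \<phi>)\<^sup>2)" by algebra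
      then show ?thesis using \<open>r\<^sup>2 = R\<^sup>2\<close> R2 by simp
    qed
    then show "range g \<subseteq> zero_cone" by (auto simp: g_def affine_in_zero_cone_iff)
  qed (use that in auto)
  \<comment> \<open>The polar radius \<open>r\<close> may be negative; then the angle
    \<open>pi\<close> gives the point with first coordinate \<open>R\<close>.\<close>
  have "g 0 = vec5 R 0 1 x y \<or> g pi = vec5 R 0 1 x y"
    using \<open>r\<^sup>2 = R\<^sup>2\<close> by (auto simp: g_def power2_eq_iff)
  moreover have "g \<theta> = vec5 p q 1 x y" by (simp add: g_def r)
  ultimately show ?thesis using g assms(2) unfolding R_def by metis
qed

text \<open>The curve is the vertical half line on which \<open>slice x\<close> decreases, reparametrised so that its
  point at infinity, which lies on the plane, is reached at \<open>u = 0\<close>.\<close>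

lemma reaches_plane_left:
  assumes "A x \<le> 0" "slice x y \<le> 0"
  shows "reaches_plane (vec5 (sqrt (- slice x y)) 0 1 x y)"
proof -
  \<comment> \<open>The direction in which \<open>slice x\<close> does not increase at
    \<open>y\<close>; being concave for \<open>A x \<le> 0\<close>, it then never increases further
    on.\<close>
  define \<sigma> :: real where "\<sigma> = (if 2 * A x * y + B x \<le> 0 then 1 else - 1)"
  have \<sigma>: "\<sigma>\<^sup>2 = 1" "\<sigma> * (2 * A x * y + B x) \<le> 0" by (auto simp: \<sigma>_def)
  \<comment> \<open>For \<open>u > 0\<close> this is \<open>u\<^sup>2\<close> times
    \<open>slice x\<close> at \<open>y + \<sigma> * (1 - u) / u\<close>, expanded around
    \<open>y\<close>; each of the three terms is nonpositive on the unit interval.\<close>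
  define h where "h = (\<lambda>u. u\<^sup>2 * slice x y + u * (1 - u) * (\<sigma> * (2 * A x * y + B x)) + A x * (1 - u)\<^sup>2)"
  define g where "g = (\<lambda>u. vec5 (sqrt (- h u)) 0 u (x * u) (y * u + \<sigma> * (1 - u)))"
  have h: "h u \<le> 0" if "u \<in> {0..1}" for u
  proof -
    have "u\<^sup>2 * slice x y \<le> 0" "u * (1 - u) * (\<sigma> * (2 * A x * y + B x)) \<le> 0" "A x * (1 - u)\<^sup>2 \<le> 0"
      using that assms \<sigma>(2) mult_nonneg_nonpos[of "u * (1 - u)" "\<sigma> * (2 * A x * y + B x)"]
      by (simp_all add: mult_nonneg_nonpos mult_nonpos_nonneg)
    then show ?thesis by (simp add: h_def)
  qed
  have "reaches_plane (g 1)"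
  proof (rule reaches_plane_curve[of 0 1 g _ 0])
    show "continuous_on {0..1} g"
      unfolding g_def h_def by (intro continuous_intros)
    show "g ` {0..1} \<subseteq> zero_cone"
    proof safe
      fix u :: real assume u: "u \<in> {0..1}"
      have "h u = C x * u\<^sup>2 + B x * u * (y * u + \<sigma> * (1 - u)) + A x * (y * u + \<sigma> * (1 - u))\<^sup>2"
        using \<sigma>(1) unfolding h_def slice_def by algebra
      then show "g u \<in> zero_cone" unfolding g_def
        using h[OF u] \<sigma>(1) by (intro vec5_in_zero_coneI) (auto simp: vec5_eq_0_iff)
    qed
    show "reaches_plane (g 0)"
      using \<sigma>(1) by (intro plane_reaches_plane) (auto simp: g_def plane_def vec5_eq_0_iff)
  qed auto
  then show ?thesis by (simp add: g_def h_def)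
qed

text \<open>Completing the square. For \<open>A x > 0\<close> the minimum of the slice is thus
  \<open>D x / A x\<close>, which ties nonempty fibres to the sign of \<open>D\<close>.\<close>

lemma slice_midpoint: "A x \<noteq> 0 \<Longrightarrow> slice x y = A x * (y + B x / (2 * A x))\<^sup>2 + D x / A x"
  by (simp add: slice_def D_def field_simps power2_eq_square)

lemma slice_nonpos_imp_D_nonpos: "A x > 0 \<Longrightarrow> slice x y \<le> 0 \<Longrightarrow> D x \<le> 0"
proof -
  assume x: "A x > 0" "slice x y \<le> 0"
  have "0 \<le> A x * (y + B x / (2 * A x))\<^sup>2" using x by simp
  then have "D x / A x \<le> 0" using x(2) slice_midpoint[of x y] x(1) by linarith
  then show ?thesis using x by (simp add: divide_le_0_iff)
qed

text \<open>A convex parabola does not rise on the way to its vertex, so the segment from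
  \<open>y\<close> to the midpoint stays where the slice is nonpositive.\<close>

lemma reaches_plane_vertical:
  assumes "A x > 0" "slice x y \<le> 0"
    and mid: "reaches_plane (vec5 (sqrt (- D x / A x)) 0 1 x (- B x / (2 * A x)))"
  shows "reaches_plane (vec5 (sqrt (- slice x y)) 0 1 x y)"
proof -
  define m where "m = - B x / (2 * A x)"
  have sl: "slice x z = A x * (z - m)\<^sup>2 + D x / A x" for z
    using slice_midpoint[of x z] assms(1) by (simp add: m_def)
  define g where "g = (\<lambda>s. let z = y + s * (m - y) in vec5 (sqrt (- slice x z)) 0 1 x z)"
  have "reaches_plane (g 0)"
  proof (rule reaches_plane_curve[of 0 1 g _ 1])
    show "continuous_on {0..1} g" unfolding g_def Let_def slice_def by (intro continuous_intros)
    show "g ` {0..1} \<subseteq> zero_cone"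
    proof safe
      fix s :: real assume s: "s \<in> {0..1}"
      have "A x * (1 - s)\<^sup>2 * (y - m)\<^sup>2 \<le> A x * 1 * (y - m)\<^sup>2"
        using s assms(1) by (intro mult_right_mono mult_left_mono) (auto simp: power_le_one_iff abs_square_le_1)
      moreover have "(y + s * (m - y) - m)\<^sup>2 = (1 - s)\<^sup>2 * (y - m)\<^sup>2" by algebra
      ultimately have "slice x (y + s * (m - y)) \<le> slice x y"
        unfolding sl by (simp add: mult.assoc)
      with assms(2) show "g s \<in> zero_cone" by (simp add: g_def Let_def affine_in_zero_cone_iff)
    qed
    show "reaches_plane (g 1)" using mid by (simp add: g_def Let_def sl m_def)
  qed auto
  then show ?thesis by (simp add: g_def Let_def)
qed

text \<open>The curve follows the midpoints of the slices down to \<open>x = - t5\<close>, after multiplication by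
  \<open>A x\<close>, which moves the pole there to a point of the plane.\<close>

lemma reaches_plane_midpoint_pole:
  assumes "- t5 < x" and D: "\<And>z. - t5 \<le> z \<Longrightarrow> z \<le> x \<Longrightarrow> D z \<le> 0" and "B (- t5) \<noteq> 0"
  shows "reaches_plane (vec5 (sqrt (- D x / A x)) 0 1 x (- B x / (2 * A x)))"
proof -
  \<comment> \<open>Here \<open>A z * sqrt (- D z / A z)\<close> has become
    \<open>sqrt (- D z * A z)\<close>, which is continuous up to \<open>- t5\<close>; there only the
    last coordinate survives.\<close>
  define g where "g = (\<lambda>z. vec5 (sqrt (- D z * A z)) 0 (A z) (z * A z) (- B z / 2))"
  have "reaches_plane (g x)"
  proof (rule reaches_plane_curve[of "- t5" x g _ "- t5"])
    show "continuous_on {- t5..x} g"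
      unfolding g_def D_def A_def B_def C_def by (intro continuous_intros) auto
    show "g ` {- t5..x} \<subseteq> zero_cone"
    proof safe
      fix z assume z: "z \<in> {- t5..x}"
      then have "- D z * A z \<ge> 0" using D[of z] by (auto simp: A_def intro!: mult_nonpos_nonneg)
      then show "g z \<in> zero_cone" unfolding g_def
      proof (intro vec5_in_zero_coneI)
        have "(sqrt (- D z * A z))\<^sup>2 = - D z * A z" using \<open>- D z * A z \<ge> 0\<close> by simp
        then show "(sqrt (- D z * A z))\<^sup>2 + 0\<^sup>2 + C z * (A z)\<^sup>2 + B z * A z * (- B z / 2)
            + A z * (- B z / 2)\<^sup>2 = 0"
          unfolding D_def by (simp add: field_simps power2_eq_square)
        show "vec5 (sqrt (- D z * A z)) 0 (A z) (z * A z) (- B z / 2) \<noteq> 0"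
        proof (cases "z = - t5")
          case True then show ?thesis using assms(3) by (simp add: vec5_eq_0_iff)
        next
          case False then show ?thesis by (simp add: vec5_eq_0_iff A_def)
        qed
      qed
    qed
    show "reaches_plane (g (- t5))"
      using assms(3) by (intro plane_reaches_plane) (simp add: plane_def g_def A_def vec5_eq_0_iff)
  qed (use assms(1) in auto)
  moreover have Ax: "A x > 0" using assms(1) by (simp add: A_def)
  ultimately have "reaches_plane ((1 / A x) *\<^sub>R g x)"
    by (intro reaches_plane_scaleR) auto
  moreover have "sqrt (- D x * A x) / A x = sqrt (- D x / A x)"
  proof -
    have "- D x / A x = (- D x * A x) / (A x)\<^sup>2"
      using Ax by (simp add: power2_eq_square)
    then show ?thesis
      using Ax by (metis abs_of_pos real_sqrt_abs real_sqrt_divide)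
  qed
  ultimately show ?thesis using Ax by (simp add: g_def scaleR_vec5 mult.commute)
qed

text \<open>Now \<open>A\<close> divides \<open>B\<close>, so the midpoints have the constant height
  \<open>- t6 / 2\<close> and there is no pole. The curve ends over \<open>- t5\<close>, where
  \<open>reaches_plane_left\<close> takes over.\<close>

lemma reaches_plane_midpoint_regular:
  assumes "- t5 < x" and D: "\<And>z. - t5 \<le> z \<Longrightarrow> z \<le> x \<Longrightarrow> D z \<le> 0" and B: "B (- t5) = 0"
  shows "reaches_plane (vec5 (sqrt (- D x / A x)) 0 1 x (- B x / (2 * A x)))"
proof -
  have "t3 = t5 * t6" using B by (simp add: B_def algebra_simps)
  then have B: "B z = t6 * A z" for z unfolding A_def B_def by algebra
  define e where "e = (\<lambda>z. C z - t6\<^sup>2 * A z / 4)"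
  have De: "D z = A z * e z" for z
    by (simp add: D_def e_def B algebra_simps power2_eq_square)
  have cont: "continuous_on UNIV e" unfolding e_def C_def A_def by (intro continuous_intros) auto
  have "e z \<le> 0" if "z \<in> {- t5<..x}" for z
    using D[of z] that unfolding De by (auto simp: mult_le_0_iff A_def)
  \<comment> \<open>At \<open>- t5\<close> both \<open>D\<close> and \<open>A\<close> vanish, so the
    sign of \<open>e\<close> there comes from continuity.\<close>
  moreover have "closure {- t5<..x} = {- t5..x}" using assms(1) by simp
  ultimately have e: "e z \<le> 0" if "z \<in> {- t5..x}" for z
    using that by (metis continuous_le_on_closure continuous_on_subset[OF cont] subset_UNIV)
  have sl: "slice z (- t6 / 2) = e z" for z
    by (simp add: slice_def e_def B field_simps power2_eq_square)
  define g where "g = (\<lambda>z. vec5 (sqrt (- e z)) 0 1 z (- t6 / 2))"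
  have "reaches_plane (g x)"
  proof (rule reaches_plane_curve[of "- t5" x g _ "- t5"])
    show "continuous_on {- t5..x} g"
      unfolding g_def by (intro continuous_intros continuous_on_subset[OF cont]) auto
    show "g ` {- t5..x} \<subseteq> zero_cone"
      using e sl by (auto simp: g_def affine_in_zero_cone_iff simp flip: minus_divide_left)
    have "e (- t5) \<le> 0" using e assms(1) by simp
    then show "reaches_plane (g (- t5))"
      unfolding g_def sl[symmetric] by (intro reaches_plane_left) (simp add: A_def)
  qed (use assms(1) in auto)
  moreover have "A x \<noteq> 0" using assms(1) by (simp add: A_def)
  ultimately show ?thesis by (simp add: g_def De B)
qed

text \<open>The hypothesis lets the midpoint curve run from any nonempty fibre right of
  \<open>- t5\<close> back to \<open>- t5\<close>. So every vector is joined to the plane, which is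
  itself connected.\<close>

lemma connected_zero_cone:
  assumes D: "\<And>x z. - t5 \<le> z \<Longrightarrow> z \<le> x \<Longrightarrow> D x \<le> 0 \<Longrightarrow> D z \<le> 0"
  shows "connected zero_cone"
proof -
  have affine: "reaches_plane (vec5 p q 1 x y)" if v: "vec5 p q 1 x y \<in> zero_cone" for p q x y
  proof (rule reaches_plane_rotate[OF v])
    have sl: "slice x y \<le> 0" using v sum_power2_ge_zero[of p q] by (simp add: affine_in_zero_cone_iff)
    show "reaches_plane (vec5 (sqrt (- slice x y)) 0 1 x y)"
    proof (cases "A x \<le> 0")
      case True then show ?thesis using sl by (rule reaches_plane_left)
    next
      case False
      then have x: "A x > 0" "- t5 < x" by (auto simp: A_def)
      have "D x \<le> 0" using x(1) sl by (rule slice_nonpos_imp_D_nonpos)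
      then have "\<And>z. - t5 \<le> z \<Longrightarrow> z \<le> x \<Longrightarrow> D z \<le> 0" using D by blast
      then show ?thesis
        using reaches_plane_midpoint_pole[OF x(2)] reaches_plane_midpoint_regular[OF x(2)]
        by (intro reaches_plane_vertical[OF x(1) sl]) blast
    qed
  qed
  have all: "reaches_plane v" if v: "v \<in> zero_cone" for v
  proof (cases "v $ 3 = 0")
    case True then show ?thesis using v zero_cone_third_0 plane_reaches_plane by blast
  next
    case False
    then obtain p q x y where w: "v = v $ 3 *\<^sub>R vec5 p q 1 x y" "vec5 p q 1 x y \<in> zero_cone"
      using zero_cone_normalise v by blast
    have "reaches_plane (v $ 3 *\<^sub>R vec5 p q 1 x y)"
      using False affine[OF w(2)] by (rule reaches_plane_scaleR)
    then show ?thesis using w(1) by simp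
  qed
  have plane: "connected_component zero_cone w w'" if "w \<in> plane" "w' \<in> plane" for w w'
    using connected_plane plane_subset_zero_cone that unfolding connected_component_def by blast
  show ?thesis
    unfolding connected_iff_connected_component
  proof (intro ballI)
    fix v v' assume "v \<in> zero_cone" "v' \<in> zero_cone"
    then obtain w w' where "w \<in> plane" "connected_component zero_cone v w"
      "w' \<in> plane" "connected_component zero_cone v' w'"
      using all unfolding reaches_plane_def by meson
    then show "connected_component zero_cone v v'"
      using plane[of w w'] by (meson connected_component_sym connected_component_trans)
  qed
qed


section \<open>Splitting off a compact part\<close>

lemma slice_bounded:
  assumes "- t5 < \<gamma>"
  obtains K where "\<And>p q x y. \<gamma> \<le> x \<Longrightarrow> x \<le> M \<Longrightarrow> p\<^sup>2 + q\<^sup>2 = - slice x y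
    \<Longrightarrow> p\<^sup>2 + q\<^sup>2 + x\<^sup>2 + y\<^sup>2 \<le> K"
proof -
  have "bounded (B ` {\<gamma>..M})" "bounded (C ` {\<gamma>..M})"
    unfolding B_def C_def by (intro compact_imp_bounded compact_continuous_image continuous_intros compact_Icc)+
  then obtain b c where b: "\<And>x. x \<in> {\<gamma>..M} \<Longrightarrow> \<bar>B x\<bar> \<le> b" and c: "\<And>x. x \<in> {\<gamma>..M} \<Longrightarrow> \<bar>C x\<bar> \<le> c"
    unfolding bounded_iff by (metis imageI real_norm_def)
  \<comment> \<open>A positive lower bound of \<open>A\<close> for \<open>x \<ge> \<gamma>\<close>,
    making the quadratics in \<open>y\<close> uniformly coercive.\<close>
  define a where "a = \<gamma> + t5"
  have a: "a > 0" using assms by (simp add: a_def)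
  define E where "E = c + b\<^sup>2 / (2 * a)"
  show ?thesis
  proof (rule that[of "E + (\<gamma>\<^sup>2 + M\<^sup>2) + 2 * E / a"])
    fix p q x y assume x: "\<gamma> \<le> x" "x \<le> M" and pq: "p\<^sup>2 + q\<^sup>2 = - slice x y"
    have "a * y\<^sup>2 \<le> A x * y\<^sup>2" using x by (intro mult_right_mono) (auto simp: a_def A_def)
    moreover have "- (B x * y) \<le> b * \<bar>y\<bar>"
    proof -
      have "- (B x * y) \<le> \<bar>B x\<bar> * \<bar>y\<bar>" by (metis abs_ge_minus_self abs_mult)
      also have "\<dots> \<le> b * \<bar>y\<bar>" using b x by (intro mult_right_mono) auto
      finally show ?thesis .
    qed
    \<comment> \<open>Half of the quadratic term absorbs the linear one.\<close>
    moreover have "b * \<bar>y\<bar> \<le> a / 2 * y\<^sup>2 + b\<^sup>2 / (2 * a)"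
    proof -
      have "a / 2 * y\<^sup>2 + b\<^sup>2 / (2 * a) - b * \<bar>y\<bar> = (a * \<bar>y\<bar> - b)\<^sup>2 / (2 * a)"
        using a by (simp add: power2_diff power_mult_distrib field_simps) (simp add: power2_eq_square)
      also have "\<dots> \<ge> 0" using a by simp
      finally show ?thesis by simp
    qed
    moreover have "- C x \<le> c" using c[of x] x by auto
    ultimately have E: "p\<^sup>2 + q\<^sup>2 + a / 2 * y\<^sup>2 \<le> E"
      using pq unfolding slice_def E_def by linarith
    then have "a / 2 * y\<^sup>2 \<le> E" using sum_power2_ge_zero[of p q] by linarith
    then have "y\<^sup>2 \<le> 2 * E / a" using a by (simp add: field_simps)
    moreover have "0 \<le> a / 2 * y\<^sup>2" using a by simp
    then have "p\<^sup>2 + q\<^sup>2 \<le> E" using E by linarith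
    moreover have "x\<^sup>2 \<le> \<gamma>\<^sup>2 + M\<^sup>2"
    proof (cases "x \<ge> 0")
      case True
      then have "x\<^sup>2 \<le> M\<^sup>2" using x by (intro power_mono) auto
      then show ?thesis using zero_le_power2[of \<gamma>] by linarith
    next
      case False
      then have "(- x)\<^sup>2 \<le> (- \<gamma>)\<^sup>2" using x by (intro power_mono) auto
      then have "x\<^sup>2 \<le> \<gamma>\<^sup>2" by simp
      then show ?thesis using zero_le_power2[of M] by linarith
    qed
    ultimately show "p\<^sup>2 + q\<^sup>2 + x\<^sup>2 + y\<^sup>2 \<le> E + (\<gamma>\<^sup>2 + M\<^sup>2) + 2 * E / a" by linarith
  qed
qed

text \<open>The fibre over \<open>\<gamma>\<close> is empty, and the part beyond it is nonempty
  because of \<open>\<delta>\<close> and bounded in the chart, so it stays away from the plane at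
  infinity.\<close>

lemma disconnected_proj_point_zero_cone:
  assumes \<gamma>: "- t5 < \<gamma>" "D \<gamma> > 0" and \<delta>: "\<gamma> < \<delta>" "D \<delta> \<le> 0"
    and M: "\<And>x. D x \<le> 0 \<Longrightarrow> x \<le> M"
  shows "\<not> connectedin proj_topology (proj_point ` zero_cone)"
proof
  assume conn: "connectedin proj_topology (proj_point ` zero_cone)"
  obtain K where K: "\<And>p q x y. \<gamma> \<le> x \<Longrightarrow> x \<le> M \<Longrightarrow> p\<^sup>2 + q\<^sup>2 = - slice x y
      \<Longrightarrow> p\<^sup>2 + q\<^sup>2 + x\<^sup>2 + y\<^sup>2 \<le> K"
    using slice_bounded[OF \<gamma>(1)] by blast
  have x_le_M: "x \<le> M" if "\<gamma> < x" "slice x y \<le> 0" for x y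
    using that \<gamma>(1) by (intro M slice_nonpos_imp_D_nonpos) (auto simp: A_def)
  have normalise: "\<exists>p q x y. v = v $ 3 *\<^sub>R vec5 p q 1 x y \<and> p\<^sup>2 + q\<^sup>2 = - slice x y"
    if v: "v \<in> zero_cone" "v $ 3 \<noteq> 0" for v
    by (rule zero_cone_normalise[OF v]) (auto simp only: affine_in_zero_cone_iff)
  define N where "N = (\<lambda>v :: real ^ 5. (v $ 1)\<^sup>2 + (v $ 2)\<^sup>2 + (v $ 4)\<^sup>2 + (v $ 5)\<^sup>2)"
  \<comment> \<open>The inequality \<open>\<gamma> < x\<close> multiplied by the square of the third
    coordinate, which makes it invariant under all nonzero scalars.\<close>
  define O1 where "O1 = {v :: real ^ 5. \<gamma> * (v $ 3)\<^sup>2 < v $ 4 * v $ 3}"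
  \<comment> \<open>The second set holds the chart points with squared norm above \<open>K\<close>
    and all nonzero vectors with third coordinate 0, in particular the plane.\<close>
  define O2 where "O2 = {v :: real ^ 5. v $ 4 * v $ 3 < \<gamma> * (v $ 3)\<^sup>2} \<union> {v. K * (v $ 3)\<^sup>2 < N v}"
  have op: "open O1" "open O2"
    unfolding O1_def O2_def N_def by (intro open_Un open_Collect_less continuous_intros)+
  have z: "0 \<notin> O1" "0 \<notin> O2" by (auto simp: O1_def O2_def N_def)
  have "c *s v \<in> O1" if "v \<in> O1" "c \<noteq> 0" for v c
  proof -
    have "c\<^sup>2 * (\<gamma> * (v $ 3)\<^sup>2) < c\<^sup>2 * (v $ 4 * v $ 3)"
      using that by (intro mult_strict_left_mono) (auto simp: O1_def)
    then show ?thesis by (simp add: O1_def power2_eq_square mult_ac)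
  qed
  then have sc1: "\<forall>v\<in>O1. \<forall>c. c \<noteq> 0 \<longrightarrow> c *s v \<in> O1" by blast
  have "c *s v \<in> O2" if "v \<in> O2" "c \<noteq> 0" for v c
  proof (cases "v $ 4 * v $ 3 < \<gamma> * (v $ 3)\<^sup>2")
    case True
    then have "c\<^sup>2 * (v $ 4 * v $ 3) < c\<^sup>2 * (\<gamma> * (v $ 3)\<^sup>2)"
      using that by (intro mult_strict_left_mono) auto
    then show ?thesis by (simp add: O2_def power2_eq_square mult_ac)
  next
    case False
    then have "c\<^sup>2 * (K * (v $ 3)\<^sup>2) < c\<^sup>2 * N v"
      using that by (intro mult_strict_left_mono) (auto simp: O2_def)
    moreover have "N (c *s v) = c\<^sup>2 * N v" by (simp add: N_def power_mult_distrib algebra_simps)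
    ultimately show ?thesis by (simp add: O2_def power_mult_distrib mult_ac)
  qed
  then have sc2: "\<forall>v\<in>O2. \<forall>c. c \<noteq> 0 \<longrightarrow> c *s v \<in> O2" by blast
  note open1 = proj_point_image_scale_invariant(1)[OF op(1) z(1) sc1]
    and mem1 = proj_point_image_scale_invariant(2)[OF op(1) z(1) sc1]
    and open2 = proj_point_image_scale_invariant(1)[OF op(2) z(2) sc2]
    and mem2 = proj_point_image_scale_invariant(2)[OF op(2) z(2) sc2]
  have nz: "v \<noteq> 0" if "v \<in> zero_cone" for v using that by (simp add: zero_cone_def)
  have cover: "v \<in> O1 \<or> v \<in> O2" if v: "v \<in> zero_cone" for v
  proof (cases "v $ 3 = 0")
    case True
    then have "v \<in> plane" using v zero_cone_third_0 by blast
    then have "N v \<noteq> 0" unfolding N_def plane_def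
      by (auto simp: vec_eq_iff forall_5 add_nonneg_eq_0_iff)
    moreover have "N v \<ge> 0" by (simp add: N_def)
    ultimately show ?thesis using True by (simp add: O2_def)
  next
    case False
    then obtain p q x y where w: "v = v $ 3 *\<^sub>R vec5 p q 1 x y" "p\<^sup>2 + q\<^sup>2 = - slice x y"
      using normalise v by blast
    \<comment> \<open>A point over \<open>\<gamma>\<close> would force
      \<open>D \<gamma> \<le> 0\<close>.\<close>
    have "x \<noteq> \<gamma>"
      using slice_nonpos_imp_D_nonpos[of x y] sum_power2_ge_zero[of p q] w(2) \<gamma> by (auto simp: A_def)
    moreover have "v $ 4 = v $ 3 * x" using arg_cong[OF w(1), of "\<lambda>v. v $ 4"] by simp
    ultimately have "v $ 4 * v $ 3 \<noteq> \<gamma> * (v $ 3)\<^sup>2" using False by (simp add: power2_eq_square)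
    then show ?thesis by (auto simp: O1_def O2_def)
  qed
  have disj: "v \<notin> O2" if v: "v \<in> zero_cone" and O1: "v \<in> O1" for v
  proof -
    have v3: "v $ 3 \<noteq> 0" using O1 by (auto simp: O1_def)
    then obtain p q x y where w: "v = v $ 3 *\<^sub>R vec5 p q 1 x y" "p\<^sup>2 + q\<^sup>2 = - slice x y"
      using normalise v by blast
    define k where "k = v $ 3"
    have v': "v = vec5 (k * p) (k * q) k (k * x) (k * y)"
      using w(1) by (simp add: k_def scaleR_vec5)
    have "\<gamma> * k\<^sup>2 < x * k\<^sup>2" using O1 by (simp add: O1_def v' power2_eq_square mult_ac)
    then have "\<gamma> < x" by (simp add: mult_less_cancel_right)
    moreover have "slice x y \<le> 0" using w(2) sum_power2_ge_zero[of p q] by linarith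
    ultimately have "p\<^sup>2 + q\<^sup>2 + x\<^sup>2 + y\<^sup>2 \<le> K" using K w(2) x_le_M by simp
    then have "k\<^sup>2 * (p\<^sup>2 + q\<^sup>2 + x\<^sup>2 + y\<^sup>2) \<le> k\<^sup>2 * K" by (intro mult_left_mono) auto
    moreover have "N v = k\<^sup>2 * (p\<^sup>2 + q\<^sup>2 + x\<^sup>2 + y\<^sup>2)"
      by (simp add: N_def v' power_mult_distrib algebra_simps)
    ultimately have "N v \<le> K * (v $ 3)\<^sup>2" by (simp add: v' mult.commute)
    then show ?thesis using O1 by (auto simp: O1_def O2_def)
  qed
  \<comment> \<open>The vertex of the slice over \<open>\<delta>\<close> supplies a point of the
    cone in \<open>O1\<close>.\<close>
  have "A \<delta> > 0" using \<gamma> \<delta> by (simp add: A_def)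
  then have "D \<delta> / A \<delta> \<le> 0" "slice \<delta> (- B \<delta> / (2 * A \<delta>)) = D \<delta> / A \<delta>"
    using \<delta> by (auto simp: slice_midpoint divide_le_0_iff)
  then have "vec5 (sqrt (- (D \<delta> / A \<delta>))) 0 1 \<delta> (- B \<delta> / (2 * A \<delta>)) \<in> zero_cone \<inter> O1"
    using \<delta>(1) by (auto simp: affine_in_zero_cone_iff O1_def)
  then have "proj_point ` O1 \<inter> proj_point ` zero_cone \<noteq> {}" by blast
  moreover have "vec5 1 0 0 0 0 \<in> zero_cone \<inter> O2"
    using plane_subset_zero_cone by (auto simp: plane_def vec5_eq_0_iff O2_def N_def)
  then have "proj_point ` O2 \<inter> proj_point ` zero_cone \<noteq> {}" by blast
  moreover have "proj_point ` zero_cone \<subseteq> proj_point ` O1 \<union> proj_point ` O2" using cover by blast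
  moreover have "proj_point ` O1 \<inter> proj_point ` O2 \<inter> proj_point ` zero_cone = {}"
  proof -
    have False if "v \<in> zero_cone" "proj_point v \<in> proj_point ` O1" "proj_point v \<in> proj_point ` O2" for v
      using that mem1[OF nz] mem2[OF nz] disj by simp
    then show ?thesis by auto
  qed
  ultimately show False
    using conn open1 open2 unfolding connectedin by meson
qed

end


section \<open>Singular points\<close>

text \<open>The last five equations are the partial derivatives written out, which turns membership
  in the singular locus into polynomial algebra.\<close>

lemma sing_locus_cubicI:
  fixes x1 x2 x3 x4 x5 :: "'a::real_normed_field"
  assumes "vec5 x1 x2 x3 x4 x5 \<noteq> 0"
    and "cubic t1 t2 t3 t4 t5 t6 (vec5 x1 x2 x3 x4 x5) = 0"
    and "2 * x1 * x3 = 0" "2 * x2 * x3 = 0"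
    and "x1\<^sup>2 + x2\<^sup>2 + 3 * of_real t1 * x3\<^sup>2 + 2 * x3 * (of_real t2 * x4 + of_real t3 * x5)
      + (of_real t4 * x4\<^sup>2 + of_real t5 * x5\<^sup>2 + of_real t6 * x4 * x5) = 0"
    and "of_real t2 * x3\<^sup>2 + x3 * (2 * of_real t4 * x4 + of_real t6 * x5) + 3 * x4\<^sup>2 + x5\<^sup>2 = 0"
    and "of_real t3 * x3\<^sup>2 + x3 * (2 * of_real t5 * x5 + of_real t6 * x4) + 2 * x4 * x5 = 0"
  shows "proj_point (vec5 x1 x2 x3 x4 x5) \<in> sing_locus (cubic t1 t2 t3 t4 t5 t6)"
proof -
  let ?F = "cubic t1 t2 t3 t4 t5 t6 :: 'a ^ 5 \<Rightarrow> 'a"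
  let ?v = "vec5 x1 x2 x3 x4 x5"
  have upd: "(\<chi> j. if j = 1 then z else ?v $ j) = vec5 z x2 x3 x4 x5"
    "(\<chi> j. if j = 2 then z else ?v $ j) = vec5 x1 z x3 x4 x5"
    "(\<chi> j. if j = 3 then z else ?v $ j) = vec5 x1 x2 z x4 x5"
    "(\<chi> j. if j = 4 then z else ?v $ j) = vec5 x1 x2 x3 z x5"
    "(\<chi> j. if j = 5 then z else ?v $ j) = vec5 x1 x2 x3 x4 z" for z
    by (simp_all add: vec_eq_iff forall_5)
  have
    "((\<lambda>z. ?F (vec5 z x2 x3 x4 x5)) has_field_derivative 2 * x1 * x3) (at x1)"
    "((\<lambda>z. ?F (vec5 x1 z x3 x4 x5)) has_field_derivative 2 * x2 * x3) (at x2)"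
    "((\<lambda>z. ?F (vec5 x1 x2 z x4 x5)) has_field_derivative x1\<^sup>2 + x2\<^sup>2 + 3 * of_real t1 * x3\<^sup>2
      + 2 * x3 * (of_real t2 * x4 + of_real t3 * x5)
      + (of_real t4 * x4\<^sup>2 + of_real t5 * x5\<^sup>2 + of_real t6 * x4 * x5)) (at x3)"
    "((\<lambda>z. ?F (vec5 x1 x2 x3 z x5)) has_field_derivative of_real t2 * x3\<^sup>2
      + x3 * (2 * of_real t4 * x4 + of_real t6 * x5) + 3 * x4\<^sup>2 + x5\<^sup>2) (at x4)"
    "((\<lambda>z. ?F (vec5 x1 x2 x3 x4 z)) has_field_derivative of_real t3 * x3\<^sup>2
      + x3 * (2 * of_real t5 * x5 + of_real t6 * x4) + 2 * x4 * x5) (at x5)"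
    unfolding cubic_def vec5_nth
    by (auto intro!: derivative_eq_intros simp: algebra_simps power2_eq_square power3_eq_cube)
  then have "\<forall>i. ((\<lambda>z. ?F (\<chi> j. if j = i then z else ?v $ j)) has_field_derivative 0) (at (?v $ i))"
    unfolding forall_5 upd vec5_nth assms(3-7) by blast
  then show ?thesis using assms(1,2) unfolding sing_locus_def by blast
qed


text \<open>The second hypothesis is the vanishing of the derivative of \<open>D\<close>. A double
  root yields a \<open>y\<close> at which \<open>slice\<close> and both its partial derivatives
  vanish, hence a singular point with third coordinate 1, besides the two known ones.\<close>

lemma (in cubic_threefold) double_root_imp_third_singular_point:
  assumes D: "D x = 0" and D': "C x + A x * (3 * x\<^sup>2 + 2 * t4 * x + t2) - B x * t6 / 2 = 0"
  shows "card (sing_locus (cubic t1 t2 t3 t4 t5 t6 :: complex ^ 5 \<Rightarrow> complex)) \<noteq> 2"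
proof
  let ?S = "sing_locus (cubic t1 t2 t3 t4 t5 t6 :: complex ^ 5 \<Rightarrow> complex)"
  assume card: "card ?S = 2"
  \<comment> \<open>The derivative of \<open>C\<close> at \<open>x\<close>; the third equation for
    \<open>y\<close> below is the derivative of the slice in \<open>x\<close>.\<close>
  define E where "E = 3 * x\<^sup>2 + 2 * t4 * x + t2"
  obtain y :: complex where
    y: "of_real (A x) * y\<^sup>2 + of_real (B x) * y + of_real (C x) = 0"
      "2 * of_real (A x) * y + of_real (B x) = 0" "y\<^sup>2 + of_real t6 * y + of_real E = 0"
  \<comment> \<open>If \<open>A x = 0\<close>, then \<open>B x\<close> and \<open>C x\<close> vanish
    too and any complex root of the third equation serves; otherwise \<open>y\<close> is the real
    vertex of the slice.\<close>
  proof (cases "A x = 0")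
    case True
    then have "B x = 0" "C x = 0" using D D' by (auto simp: D_def)
    define r where "r = csqrt ((of_real t6)\<^sup>2 - 4 * of_real E)"
    have r: "r\<^sup>2 = (of_real t6)\<^sup>2 - 4 * of_real E" by (simp add: r_def)
    have "((r - of_real t6) / 2)\<^sup>2 + of_real t6 * ((r - of_real t6) / 2) + of_real E = 0"
      using r by (simp add: power_divide power2_diff) (simp add: field_simps power2_eq_square)
    then show ?thesis using that[of "(r - of_real t6) / 2"] True \<open>B x = 0\<close> \<open>C x = 0\<close> by simp
  next
    case False
    define z where "z = - B x / (2 * A x)"
    have z: "2 * A x * z + B x = 0" using False by (simp add: z_def)
    have "4 * A x * (A x * z\<^sup>2 + B x * z + C x) = (2 * A x * z + B x)\<^sup>2 + 4 * D x"
      by (simp add: D_def algebra_simps power2_eq_square)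
    then have 1: "A x * z\<^sup>2 + B x * z + C x = 0" using False D z by simp
    have "A x * (z\<^sup>2 + t6 * z + E) = (C x + A x * E - B x * t6 / 2)
        - (A x * z\<^sup>2 + B x * z + C x) + (2 * A x * z + B x) * (z + t6 / 2)"
      by (simp add: algebra_simps power2_eq_square)
    then have 2: "z\<^sup>2 + t6 * z + E = 0" using False z 1 D' by (simp add: E_def)
    show ?thesis
    proof (rule that[of "of_real z"])
      show "of_real (A x) * (of_real z)\<^sup>2 + of_real (B x) * of_real z + of_real (C x) = (0 :: complex)"
        using arg_cong[OF 1, of "of_real :: real \<Rightarrow> complex"] by simp
      show "2 * of_real (A x) * of_real z + of_real (B x) = (0 :: complex)"
        using arg_cong[OF z, of "of_real :: real \<Rightarrow> complex"] by simp
      show "(of_real z)\<^sup>2 + of_real t6 * of_real z + of_real E = (0 :: complex)"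
        using arg_cong[OF 2, of "of_real :: real \<Rightarrow> complex"] by simp
    qed
  qed
  define X :: complex where "X = of_real x"
  note e = y[unfolded A_def B_def C_def E_def of_real_add of_real_mult of_real_power of_real_numeral,
      folded X_def]
  \<comment> \<open>The derivative in the third coordinate follows from the others and the cubic
    itself, by Euler's relation.\<close>
  have e': "3 * of_real t1 + 2 * (of_real t2 * X + of_real t3 * y)
      + (of_real t4 * X\<^sup>2 + of_real t5 * y\<^sup>2 + of_real t6 * X * y) = 0"
    using e by algebra
  have "proj_point (vec5 0 0 1 X y) \<in> ?S"
  proof (rule sing_locus_cubicI)
    show "vec5 0 0 1 X y \<noteq> 0" by (simp add: vec5_eq_0_iff)
    show "cubic t1 t2 t3 t4 t5 t6 (vec5 0 0 1 X y) = 0"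
      using e(1) by (simp add: cubic_def algebra_simps power2_eq_square power3_eq_cube)
    show "0\<^sup>2 + 0\<^sup>2 + 3 * of_real t1 * 1\<^sup>2 + 2 * 1 * (of_real t2 * X + of_real t3 * y) +
      (of_real t4 * X\<^sup>2 + of_real t5 * y\<^sup>2 + of_real t6 * X * y) = 0" using e' by simp
    show "of_real t2 * 1\<^sup>2 + 1 * (2 * of_real t4 * X + of_real t6 * y) + 3 * X\<^sup>2 + y\<^sup>2 = 0"
      using e(3) by (simp add: algebra_simps)
    show "of_real t3 * 1\<^sup>2 + 1 * (2 * of_real t5 * y + of_real t6 * X) + 2 * X * y = 0"
      using e(2) by (simp add: algebra_simps)
  qed simp_all
  moreover have "proj_point (vec5 1 \<i> 0 0 0) \<in> ?S" "proj_point (vec5 1 (- \<i>) 0 0 0) \<in> ?S"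
    by (rule sing_locus_cubicI; simp add: vec5_eq_0_iff cubic_def)+
  \<comment> \<open>Infinite sets have cardinality 0 by convention, so cardinality 2 gives
    finiteness.\<close>
  moreover have "finite ?S" using card by (intro card_ge_0_finite) simp
  ultimately have "card {proj_point (vec5 0 0 1 X y), proj_point (vec5 1 \<i> 0 0 0),
      proj_point (vec5 1 (- \<i>) 0 0 0)} \<le> 2"
    unfolding card[symmetric] by (intro card_mono) auto
  moreover have "proj_point (vec5 0 0 1 X y) \<noteq> proj_point (vec5 1 \<i> 0 0 0)"
    "proj_point (vec5 0 0 1 X y) \<noteq> proj_point (vec5 1 (- \<i>) 0 0 0)"
    "proj_point (vec5 1 \<i> 0 0 0) \<noteq> proj_point (vec5 1 (- \<i>) 0 0 0)"
    by (auto dest!: proj_point_eqD simp: vec_eq_iff forall_5)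
  ultimately show False by simp
qed

section \<open>The criterion in terms of the roots\<close>

theorem lemma3p9:
  fixes t1 t2 t3 t4 t5 t6 :: real
  defines "X\<^sub>R \<equiv> (cubic t1 t2 t3 t4 t5 t6 :: real ^ 5 \<Rightarrow> real)"
    and "X\<^sub>C \<equiv> (cubic t1 t2 t3 t4 t5 t6 :: complex ^ 5 \<Rightarrow> complex)"
    and "roots \<equiv> {x :: real. poly (D2 t1 t2 t3 t4 t5 t6) x = 0}"
  assumes "sing_locus X\<^sub>R = {}"
    and "has_2D4_singularities X\<^sub>C"
  shows "connectedin proj_topology (proj_hypersurface X\<^sub>R) \<longleftrightarrow>
     roots = {}
     \<or> (\<exists>\<alpha>1 \<alpha>2. \<alpha>1 < \<alpha>2 \<and> roots = {\<alpha>1, \<alpha>2} \<and> \<alpha>1 \<le> - t5)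
     \<or> (\<exists>\<alpha>1 \<alpha>2 \<alpha>3 \<alpha>4. \<alpha>1 < \<alpha>2 \<and> \<alpha>2 < \<alpha>3 \<and> \<alpha>3 < \<alpha>4 \<and> roots = {\<alpha>1, \<alpha>2, \<alpha>3, \<alpha>4} \<and> \<alpha>3 \<le> - t5)"
proof -
  interpret cubic_threefold t1 t2 t3 t4 t5 t6 .
  have X: "proj_hypersurface X\<^sub>R = proj_point ` zero_cone"
    by (simp add: X\<^sub>R_def proj_hypersurface_def zero_cone_def)
  have roots: "roots = {x. D x = 0}" by (simp add: roots_def poly_D2)
  have "4 * x ^ 3 + 3 * (t4 + t5) * x\<^sup>2 + 2 * (t2 + t4 * t5 - t6\<^sup>2 / 4) * x
      + (t1 + t2 * t5 - t3 * t6 / 2) \<noteq> 0" if "D x = 0" for x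
  proof
    assume "4 * x ^ 3 + 3 * (t4 + t5) * x\<^sup>2 + 2 * (t2 + t4 * t5 - t6\<^sup>2 / 4) * x
      + (t1 + t2 * t5 - t3 * t6 / 2) = 0"
    \<comment> \<open>The derivative of \<open>D\<close> regrouped by the product rule.\<close>
    then have "C x + A x * (3 * x\<^sup>2 + 2 * t4 * x + t2) - B x * t6 / 2 = 0"
      by (simp add: A_def B_def C_def algebra_simps power2_eq_square power3_eq_cube)
    with that double_root_imp_third_singular_point assms(5) show False
      by (simp add: has_2D4_singularities_def X\<^sub>C_def)
  qed
  then have simple: "\<forall>x. D x = 0 \<longrightarrow> 4 * x ^ 3 + 3 * (t4 + t5) * x\<^sup>2
      + 2 * (t2 + t4 * t5 - t6\<^sup>2 / 4) * x + (t1 + t2 * t5 - t3 * t6 / 2) \<noteq> 0"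
    by blast
  have connected: "connectedin proj_topology (proj_point ` zero_cone)"
    if "\<And>x z. - t5 \<le> z \<Longrightarrow> z \<le> x \<Longrightarrow> D x \<le> 0 \<Longrightarrow> D z \<le> 0"
    using connected_zero_cone[OF that]
    by (intro connectedin_proj_point_image) (auto simp: zero_cone_def)
  show ?thesis
  proof (rule monic_quartic_simple_roots[OF D_expand D_neg_t5_le_0 simple])
    fix a b assume two: "a < b" "\<And>x. D x = 0 \<longleftrightarrow> x = a \<or> x = b"
      "\<And>x. D x \<le> 0 \<longleftrightarrow> a \<le> x \<and> x \<le> b"
    \<comment> \<open>Since \<open>D (- t5) \<le> 0\<close>, the point \<open>- t5\<close> lies
      between the two roots, so both sides of the equivalence hold.\<close>
    have "a \<le> - t5" using D_neg_t5_le_0 two(3) by blast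
    then have "connectedin proj_topology (proj_point ` zero_cone)"
      by (intro connected) (auto simp: two(3))
    moreover have "roots = {a, b}" using two(2) by (auto simp: roots)
    ultimately show ?thesis unfolding X using two(1) \<open>a \<le> - t5\<close> by blast
  next
    fix a b c d assume four: "a < b" "b < c" "c < d"
      "\<And>x. D x = (x - a) * (x - b) * (x - c) * (x - d)"
    have le: "D x \<le> 0 \<longleftrightarrow> a \<le> x \<and> x \<le> b \<or> c \<le> x \<and> x \<le> d" for x
      unfolding four(4) by (rule four_factors_le_0_iff[OF four(1-3)])
    have rt: "roots = {a, b, c, d}" by (auto simp: roots four(4))
    then have "card roots = 4" using four(1-3) by simp
    moreover have "card {\<alpha>1, \<alpha>2} \<noteq> 4" for \<alpha>1 \<alpha>2 :: real by (simp add: card_insert_if)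
    ultimately have no_two: "roots \<noteq> {\<alpha>1, \<alpha>2}" for \<alpha>1 \<alpha>2
      by metis
    \<comment> \<open>A finite set has only one increasing enumeration.\<close>
    have uniq: "\<alpha>3 = c" if "\<alpha>1 < \<alpha>2" "\<alpha>2 < \<alpha>3" "\<alpha>3 < \<alpha>4" "roots = {\<alpha>1, \<alpha>2, \<alpha>3, \<alpha>4}" for \<alpha>1 \<alpha>2 \<alpha>3 \<alpha>4
      using strict_sorted_equal[of "[\<alpha>1, \<alpha>2, \<alpha>3, \<alpha>4]" "[a, b, c, d]"] that four(1-3) rt by simp
    have rhs: "(\<exists>\<alpha>1 \<alpha>2 \<alpha>3 \<alpha>4. \<alpha>1 < \<alpha>2 \<and> \<alpha>2 < \<alpha>3 \<and> \<alpha>3 < \<alpha>4 \<and> roots = {\<alpha>1, \<alpha>2, \<alpha>3, \<alpha>4} \<and> \<alpha>3 \<le> - t5)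
        \<longleftrightarrow> c \<le> - t5"
      using uniq rt four(1-3) by blast
    have "connectedin proj_topology (proj_point ` zero_cone)" if "c \<le> - t5"
      using that four(1-3) by (intro connected) (auto simp: le)
    moreover have "\<not> connectedin proj_topology (proj_point ` zero_cone)" if "\<not> c \<le> - t5"
    proof -
      \<comment> \<open>Of the two intervals with \<open>D \<le> 0\<close> only the left one can
        contain \<open>- t5\<close>, so the gap between \<open>b\<close> and \<open>c\<close> lies
        to its right and its midpoint serves as \<open>\<gamma>\<close>.\<close>
      have "- t5 \<le> b" using D_neg_t5_le_0 that unfolding le by simp
      show ?thesis
      proof (rule disconnected_proj_point_zero_cone)
        show "- t5 < (b + c) / 2" "(b + c) / 2 < c" using \<open>- t5 \<le> b\<close> four(2) by auto
        show "0 < D ((b + c) / 2)" using le[of "(b + c) / 2"] four by auto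
        show "D c \<le> 0" by (simp add: four(4))
        show "x \<le> d" if "D x \<le> 0" for x using that four(1-3) unfolding le by linarith
      qed
    qed
    ultimately show ?thesis unfolding X rhs using no_two rt by blast
  qed
qed

end
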